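(* Let $\pi:A\to B$ be a square zero extension of curved algebras. Then $\mathrm{MC}_{dg}(\pi):\mathrm{MC}_{dg}(A)\to\mathrm{MC}_{dg}(B)$ is a fibration of dg categories.
   Context: Throughout, $k$ is a fixed perfect field, everything is over $k$ and cohomologically $\mathbb Z$-graded, and $[a,b]=ab-(-1)^{|a||b|}ba$. A curved algebra is a unital graded algebra $A$ with a degree $1$ derivation $d$ and an element $h\in A^2$ (the curvature) with $dh=0$ and $d^2(a)=[h,a]$ for all $a$. A morphism $A\to B$ is a pair $(f,b)$ with $f$ a graded algebra map and $b\in B^1$ such that $f(da)=d(fa)+[b,fa]$ and $f(h_A)=h_B+db+b^2$; composition is $(g,c)(f,b)=(gf,c+g(b))$. A morphism $\pi:A\to B$ of curved algebras is a square zero extension if (its underlying graded algebra map) is surjective and $L=\ker(\pi)$ satisfies $L^2=0$. MC elements of a curved algebra $A$ are the $x\in A^1$ with $h+dx+x^2=0$. The dg category $\mathrm{MC}_{dg}(A)$ has the MC elements of $A$ as objects (it may be empty), and the complex of morphisms $x\to y$ is the graded space $A$ with differential $a\mapsto da+ya-(-1)^{|a|}ax$; composition is multiplication. A morphism $(f,b)$ acts by $x\mapsto b+f(x)$ on objects and by $f$ on morphisms. A fibration of dg categories is a dg functor $F$ that is surjective on hom-complexes and such that $H^0F$ is an isofibration. *)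

theory Defs
  imports "HOL-Computational_Algebra.Polynomial"
begin

section \<open>Perfect fields\<close>

text \<open>Every irreducible polynomial is separable, i.e. coprime to its formal derivative.\<close>

definition perfect_field :: "'k::field itself \<Rightarrow> bool" where
  "perfect_field _ \<longleftrightarrow> (\<forall>p :: 'k poly. irreducible p \<longrightarrow> coprime p (pderiv p))"

section \<open>Graded algebras and curved algebras\<close>

text \<open>\<open>koszul m a\<close> is $(-1)^m a$.\<close>

definition koszul :: "int \<Rightarrow> 'a::ab_group_add \<Rightarrow> 'a" where
  "koszul m a = (if even m then a else - a)"

text \<open>\<open>gcomm m n a b\<close> is the graded commutator $[a,b]$ of elements of degrees
  \<open>m\<close> and \<open>n\<close>. The degrees are explicit arguments because
  they cannot be read off from a zero element.\<close>

definition gcomm :: "int \<Rightarrow> int \<Rightarrow> 'a::ring \<Rightarrow> 'a \<Rightarrow> 'a" where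
  "gcomm m n a b = a * b - koszul (m * n) (b * a)"

text \<open>A grading on a vector space is an internal direct sum decomposition indexed by the
  integers.\<close>

definition graded_space :: "('k::field \<Rightarrow> 'a::ab_group_add \<Rightarrow> 'a) \<Rightarrow> (int \<Rightarrow> 'a set) \<Rightarrow> bool" where
  "graded_space s G \<longleftrightarrow>
     vector_space s \<and>
     (\<forall>n. module.subspace s (G n)) \<and>
     (\<forall>a. \<exists>!c. (\<forall>n. c n \<in> G n) \<and> finite {n. c n \<noteq> 0} \<and> a = (\<Sum>n | c n \<noteq> 0. c n))"

text \<open>The ring structure of the algebra comes from the sort \<open>{ring, monoid_mult}\<close>
  (unital associative rings). The class \<open>ring_1\<close> would exclude the zero algebra.\<close>

definition graded_algebra ::
  "('k::field \<Rightarrow> 'a::{ring,monoid_mult} \<Rightarrow> 'a) \<Rightarrow> (int \<Rightarrow> 'a set) \<Rightarrow> bool" where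
  "graded_algebra s G \<longleftrightarrow>
     graded_space s G \<and>
     (\<forall>c a b. s c (a * b) = s c a * b \<and> s c (a * b) = a * s c b) \<and>
     1 \<in> G 0 \<and>
     (\<forall>m n. \<forall>a\<in>G m. \<forall>b\<in>G n. a * b \<in> G (m + n))"

record ('k, 'a) curved =
  scl :: "'k \<Rightarrow> 'a \<Rightarrow> 'a"
  gr :: "int \<Rightarrow> 'a set"
  der :: "'a \<Rightarrow> 'a"
  curv :: 'a

definition curved_algebra :: "('k::field, 'a::{ring,monoid_mult}) curved \<Rightarrow> bool" where
  "curved_algebra A \<longleftrightarrow>
     graded_algebra (scl A) (gr A) \<and>
     Vector_Spaces.linear (scl A) (scl A) (der A) \<and>
     (\<forall>n. \<forall>a\<in>gr A n. der A a \<in> gr A (n + 1)) \<and>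
     (\<forall>m n. \<forall>a\<in>gr A m. \<forall>b\<in>gr A n.
        der A (a * b) = der A a * b + koszul m (a * der A b)) \<and>
     curv A \<in> gr A 2 \<and>
     der A (curv A) = 0 \<and>
     (\<forall>n. \<forall>a\<in>gr A n. der A (der A a) = gcomm 2 n (curv A) a)"

definition graded_algebra_map ::
  "('k::field \<Rightarrow> 'a::{ring,monoid_mult} \<Rightarrow> 'a) \<Rightarrow> (int \<Rightarrow> 'a set) \<Rightarrow>
   ('k \<Rightarrow> 'b::{ring,monoid_mult} \<Rightarrow> 'b) \<Rightarrow> (int \<Rightarrow> 'b set) \<Rightarrow> ('a \<Rightarrow> 'b) \<Rightarrow> bool" where
  "graded_algebra_map s G t H f \<longleftrightarrow>
     Vector_Spaces.linear s t f \<and>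
     (\<forall>n. \<forall>a\<in>G n. f a \<in> H n) \<and>
     (\<forall>a b. f (a * b) = f a * f b) \<and>
     f 1 = 1"

text \<open>A morphism is a pair $(f,b)$.\<close>

definition curved_morphism ::
  "('k::field, 'a::{ring,monoid_mult}) curved \<Rightarrow> ('k, 'b::{ring,monoid_mult}) curved \<Rightarrow>
   ('a \<Rightarrow> 'b) \<times> 'b \<Rightarrow> bool" where
  "curved_morphism A B \<pi> \<longleftrightarrow> (case \<pi> of (f, b) \<Rightarrow>
     graded_algebra_map (scl A) (gr A) (scl B) (gr B) f \<and>
     b \<in> gr B 1 \<and>
     (\<forall>n. \<forall>a\<in>gr A n. f (der A a) = der B (f a) + gcomm 1 n b (f a)) \<and>
     f (curv A) = curv B + der B b + b * b)"

definition square_zero_extension ::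
  "('k::field, 'a::{ring,monoid_mult}) curved \<Rightarrow> ('k, 'b::{ring,monoid_mult}) curved \<Rightarrow>
   ('a \<Rightarrow> 'b) \<times> 'b \<Rightarrow> bool" where
  "square_zero_extension A B \<pi> \<longleftrightarrow>
     curved_morphism A B \<pi> \<and>
     surj (fst \<pi>) \<and>
     (let L = {a. fst \<pi> a = 0} in \<forall>a\<in>L. \<forall>b\<in>L. a * b = 0)"

section \<open>Categories and isofibrations\<close>

record ('o, 'm) cat =
  obj :: "'o set"
  mor :: "'o \<Rightarrow> 'o \<Rightarrow> 'm set"
  cmp :: "'o \<Rightarrow> 'o \<Rightarrow> 'o \<Rightarrow> 'm \<Rightarrow> 'm \<Rightarrow> 'm" \<comment> \<open>\<open>cmp C x y z g f\<close> is $g \circ f : x \to y \to z$\<close>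
  idm :: "'o \<Rightarrow> 'm"

definition is_iso :: "('o, 'm) cat \<Rightarrow> 'o \<Rightarrow> 'o \<Rightarrow> 'm \<Rightarrow> bool" where
  "is_iso C x y u \<longleftrightarrow> u \<in> mor C x y \<and>
     (\<exists>v\<in>mor C y x. cmp C x y x v u = idm C x \<and> cmp C y x y u v = idm C y)"

text \<open>A functor is a pair of its action on objects and its action on morphisms; the
  latter takes the source and the target as arguments.\<close>

definition isofibration ::
  "('o, 'm) cat \<Rightarrow> ('p, 'n) cat \<Rightarrow> ('o \<Rightarrow> 'p) \<times> ('o \<Rightarrow> 'o \<Rightarrow> 'm \<Rightarrow> 'n) \<Rightarrow> bool" where
  "isofibration C D F \<longleftrightarrow>
     (\<forall>x\<in>obj C. \<forall>y\<in>obj D. \<forall>u. is_iso D (fst F x) y u \<longrightarrow>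
        (\<exists>x'\<in>obj C. \<exists>v. is_iso C x x' v \<and> fst F x' = y \<and> snd F x x' v = u))"

section \<open>Dg categories\<close>

text \<open>The hom-complexes are given degreewise: \<open>hom C x y n\<close> is the degree \<open>n\<close> part, a
  subspace of an ambient vector space on the type of morphisms, and the differential and the
  composition take the degrees of their arguments as parameters. The degree \<open>n\<close> parts for
  different \<open>n\<close> or different objects may overlap in the ambient space.\<close>

record ('o, 'k, 'm) dgcat =
  dgobj :: "'o set"
  dgscl :: "'k \<Rightarrow> 'm \<Rightarrow> 'm"
  hom :: "'o \<Rightarrow> 'o \<Rightarrow> int \<Rightarrow> 'm set"
  diff :: "'o \<Rightarrow> 'o \<Rightarrow> int \<Rightarrow> 'm \<Rightarrow> 'm"
  dgcmp :: "'o \<Rightarrow> 'o \<Rightarrow> 'o \<Rightarrow> int \<Rightarrow> int \<Rightarrow> 'm \<Rightarrow> 'm \<Rightarrow> 'm"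
    \<comment> \<open>\<open>dgcmp C x y z m n g f\<close> is $g \circ f$ for $g : y \to z$ of degree \<open>m\<close> and $f : x \to y$ of degree \<open>n\<close>\<close>
  dgid :: "'o \<Rightarrow> 'm"

text \<open>Linearity of a map defined on a subspace only.\<close>

definition linear_between ::
  "('k \<Rightarrow> 'm::ab_group_add \<Rightarrow> 'm) \<Rightarrow> 'm set \<Rightarrow>
   ('k \<Rightarrow> 'n::ab_group_add \<Rightarrow> 'n) \<Rightarrow> 'n set \<Rightarrow> ('m \<Rightarrow> 'n) \<Rightarrow> bool" where
  "linear_between s V t W f \<longleftrightarrow>
     (\<forall>a\<in>V. f a \<in> W) \<and>
     (\<forall>a\<in>V. \<forall>b\<in>V. f (a + b) = f a + f b) \<and>
     (\<forall>c. \<forall>a\<in>V. f (s c a) = t c (f a))"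

definition dg_category :: "('o, 'k::field, 'm::ab_group_add) dgcat \<Rightarrow> bool" where
  "dg_category C \<longleftrightarrow>
     vector_space (dgscl C) \<and>
     \<comment> \<open>hom-complexes\<close>
     (\<forall>x\<in>dgobj C. \<forall>y\<in>dgobj C. \<forall>n.
        module.subspace (dgscl C) (hom C x y n) \<and>
        linear_between (dgscl C) (hom C x y n) (dgscl C) (hom C x y (n + 1)) (diff C x y n) \<and>
        (\<forall>f\<in>hom C x y n. diff C x y (n + 1) (diff C x y n f) = 0)) \<and>
     \<comment> \<open>composition is bilinear and a chain map\<close>
     (\<forall>x\<in>dgobj C. \<forall>y\<in>dgobj C. \<forall>z\<in>dgobj C. \<forall>m n.
        (\<forall>g\<in>hom C y z m.
           linear_between (dgscl C) (hom C x y n) (dgscl C) (hom C x z (m + n))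
             (\<lambda>f. dgcmp C x y z m n g f)) \<and>
        (\<forall>f\<in>hom C x y n.
           linear_between (dgscl C) (hom C y z m) (dgscl C) (hom C x z (m + n))
             (\<lambda>g. dgcmp C x y z m n g f)) \<and>
        (\<forall>g\<in>hom C y z m. \<forall>f\<in>hom C x y n.
           diff C x z (m + n) (dgcmp C x y z m n g f) =
             dgcmp C x y z (m + 1) n (diff C y z m g) f
             + koszul m (dgcmp C x y z m (n + 1) g (diff C x y n f)))) \<and>
     \<comment> \<open>associativity\<close>
     (\<forall>w\<in>dgobj C. \<forall>x\<in>dgobj C. \<forall>y\<in>dgobj C. \<forall>z\<in>dgobj C. \<forall>l m n.
        \<forall>p\<in>hom C y z l. \<forall>g\<in>hom C x y m. \<forall>f\<in>hom C w x n.
          dgcmp C w y z l (m + n) p (dgcmp C w x y m n g f) =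
          dgcmp C w x z (l + m) n (dgcmp C x y z l m p g) f) \<and>
     \<comment> \<open>identities\<close>
     (\<forall>x\<in>dgobj C. dgid C x \<in> hom C x x 0 \<and> diff C x x 0 (dgid C x) = 0) \<and>
     (\<forall>x\<in>dgobj C. \<forall>y\<in>dgobj C. \<forall>n. \<forall>f\<in>hom C x y n.
        dgcmp C x x y n 0 f (dgid C x) = f \<and> dgcmp C x y y 0 n (dgid C y) f = f)"

definition dg_functor ::
  "('o, 'k::field, 'm::ab_group_add) dgcat \<Rightarrow> ('p, 'k, 'n::ab_group_add) dgcat \<Rightarrow>
   ('o \<Rightarrow> 'p) \<times> ('o \<Rightarrow> 'o \<Rightarrow> int \<Rightarrow> 'm \<Rightarrow> 'n) \<Rightarrow> bool" where
  "dg_functor C D F \<longleftrightarrow> (case F of (F0, F1) \<Rightarrow>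
     dg_category C \<and> dg_category D \<and>
     (\<forall>x\<in>dgobj C. F0 x \<in> dgobj D) \<and>
     (\<forall>x\<in>dgobj C. \<forall>y\<in>dgobj C. \<forall>n.
        linear_between (dgscl C) (hom C x y n) (dgscl D) (hom D (F0 x) (F0 y) n) (F1 x y n) \<and>
        (\<forall>f\<in>hom C x y n. F1 x y (n + 1) (diff C x y n f) = diff D (F0 x) (F0 y) n (F1 x y n f))) \<and>
     (\<forall>x\<in>dgobj C. \<forall>y\<in>dgobj C. \<forall>z\<in>dgobj C. \<forall>m n. \<forall>g\<in>hom C y z m. \<forall>f\<in>hom C x y n.
        F1 x z (m + n) (dgcmp C x y z m n g f) =
        dgcmp D (F0 x) (F0 y) (F0 z) m n (F1 y z m g) (F1 x y n f)) \<and>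
     (\<forall>x\<in>dgobj C. F1 x x 0 (dgid C x) = dgid D (F0 x)))"

text \<open>Morphisms of $H^0(C)$ are cohomology classes, i.e. cosets of the degree 0 coboundaries
  in the degree 0 cocycles.\<close>

definition cocycles0 :: "('o, 'k, 'm::ab_group_add) dgcat \<Rightarrow> 'o \<Rightarrow> 'o \<Rightarrow> 'm set" where
  "cocycles0 C x y = {f \<in> hom C x y 0. diff C x y 0 f = 0}"

definition coboundaries0 :: "('o, 'k, 'm::ab_group_add) dgcat \<Rightarrow> 'o \<Rightarrow> 'o \<Rightarrow> 'm set" where
  "coboundaries0 C x y = diff C x y (-1) ` hom C x y (-1)"

definition class0 :: "('o, 'k, 'm::ab_group_add) dgcat \<Rightarrow> 'o \<Rightarrow> 'o \<Rightarrow> 'm \<Rightarrow> 'm set" where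
  "class0 C x y f = {g \<in> cocycles0 C x y. g - f \<in> coboundaries0 C x y}"

text \<open>Operations on classes are unions over representatives; in a dg category all
  representatives yield the same class.\<close>

definition H0 :: "('o, 'k, 'm::ab_group_add) dgcat \<Rightarrow> ('o, 'm set) cat" where
  "H0 C = \<lparr>obj = dgobj C,
           mor = (\<lambda>x y. class0 C x y ` cocycles0 C x y),
           cmp = (\<lambda>x y z V U. \<Union>g\<in>V. \<Union>f\<in>U. class0 C x z (dgcmp C x y z 0 0 g f)),
           idm = (\<lambda>x. class0 C x x (dgid C x))\<rparr>"

definition H0_functor ::
  "('p, 'k, 'n::ab_group_add) dgcat \<Rightarrow>
   ('o \<Rightarrow> 'p) \<times> ('o \<Rightarrow> 'o \<Rightarrow> int \<Rightarrow> 'm \<Rightarrow> 'n) \<Rightarrow>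
   ('o \<Rightarrow> 'p) \<times> ('o \<Rightarrow> 'o \<Rightarrow> 'm set \<Rightarrow> 'n set)" where
  "H0_functor D F = (case F of (F0, F1) \<Rightarrow>
     (F0, \<lambda>x y U. \<Union>f\<in>U. class0 D (F0 x) (F0 y) (F1 x y 0 f)))"

definition dg_fibration ::
  "('o, 'k::field, 'm::ab_group_add) dgcat \<Rightarrow> ('p, 'k, 'n::ab_group_add) dgcat \<Rightarrow>
   ('o \<Rightarrow> 'p) \<times> ('o \<Rightarrow> 'o \<Rightarrow> int \<Rightarrow> 'm \<Rightarrow> 'n) \<Rightarrow> bool" where
  "dg_fibration C D F \<longleftrightarrow>
     dg_functor C D F \<and>
     (\<forall>x\<in>dgobj C. \<forall>y\<in>dgobj C. \<forall>n.
        snd F x y n ` hom C x y n = hom D (fst F x) (fst F y) n) \<and>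
     isofibration (H0 C) (H0 D) (H0_functor D F)"

section \<open>The Maurer--Cartan dg category\<close>

definition MC :: "('k, 'a::{ring,monoid_mult}) curved \<Rightarrow> 'a set" where
  "MC A = {x \<in> gr A 1. curv A + der A x + x * x = 0}"

definition MC_dg :: "('k, 'a::{ring,monoid_mult}) curved \<Rightarrow> ('a, 'k, 'a) dgcat" where
  "MC_dg A = \<lparr>dgobj = MC A,
              dgscl = scl A,
              hom = (\<lambda>x y n. gr A n),
              diff = (\<lambda>x y n a. der A a + y * a - koszul n (a * x)),
              dgcmp = (\<lambda>x y z m n g f. g * f),
              dgid = (\<lambda>x. 1)\<rparr>"

definition MC_dg_map ::
  "('a \<Rightarrow> 'b) \<times> 'b::{ring,monoid_mult} \<Rightarrow> ('a \<Rightarrow> 'b) \<times> ('a \<Rightarrow> 'a \<Rightarrow> int \<Rightarrow> 'a \<Rightarrow> 'b)" where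
  "MC_dg_map \<pi> = (case \<pi> of (f, b) \<Rightarrow> (\<lambda>x. b + f x, \<lambda>x y n. f))"

end

theory Submission
  imports Defs
begin

text \<open>Let $L$ be the kernel of $\pi$. Given an isomorphism $[u]$ in $H^0$ from $\pi(x)$ to $y$, lift
  $y$ to any $Y \in A^1$ and $u$ to any $U \in A^0$. The curvature of $Y$ and the twisted differential
  of $U$ lie in $L$ and form a cocycle in the cone of right multiplication by $U$ on $L$. As
  $L^2 = 0$, this multiplication only depends on $u$, hence is a homotopy equivalence and its cone is
  acyclic; a primitive of the cocycle corrects $Y$ to a Maurer--Cartan element $x'$ and $U$ to a closed
  map $x \to x'$. The same acyclicity lifts a homotopy inverse of $u$ to a left inverse $V$ of $U$ up
  to homotopy. Applied to $V$ in turn, it shows that $U$ is an isomorphism in $H^0$.\<close>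

section \<open>Signs\<close>

lemma koszul_simps [simp]:
  "koszul 0 a = a" "koszul 1 a = - a" "koszul 2 a = a" "koszul (-1) a = - a" "koszul m 0 = 0"
  by (auto simp: koszul_def)

lemma koszul_koszul [simp]: "koszul m (koszul m a) = a"
  by (auto simp: koszul_def)

lemma koszul_Suc: "koszul (m + 1) a = - koszul m a"
  by (auto simp: koszul_def)

lemma koszul_add_arg: "koszul m (a + b) = koszul m a + koszul m b"
  by (auto simp: koszul_def)

lemma koszul_minus_arg: "koszul m (- a) = - koszul m a"
  by (auto simp: koszul_def)

lemma koszul_diff_arg: "koszul m (a - b) = koszul m a - koszul m b"
  by (auto simp: koszul_def)

lemma koszul_mult_left: "koszul m a * b = koszul m (a * b)" for a b :: "'a::ring"
  by (auto simp: koszul_def)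

lemma koszul_mult_right: "a * koszul m b = koszul m (a * b)" for a b :: "'a::ring"
  by (auto simp: koszul_def)

section \<open>Twisted differentials of a curved algebra\<close>

text \<open>Twisting by degree 1 elements that need not be Maurer--Cartan: the resulting structure is
  a dg category except that the differential only squares to the difference of the curvatures.\<close>

definition tw :: "('k, 'a::{ring,monoid_mult}) curved \<Rightarrow> 'a \<Rightarrow> 'a \<Rightarrow> int \<Rightarrow> 'a \<Rightarrow> 'a" where
  "tw A x y n a = der A a + y * a - koszul n (a * x)"

definition twcurv :: "('k, 'a::{ring,monoid_mult}) curved \<Rightarrow> 'a \<Rightarrow> 'a" where
  "twcurv A x = curv A + der A x + x * x"

lemma MC_iff: "x \<in> MC A \<longleftrightarrow> x \<in> gr A 1 \<and> twcurv A x = 0"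
  by (simp add: MC_def twcurv_def)

lemma MC_dg_simps [simp]:
  "dgobj (MC_dg A) = MC A" "dgscl (MC_dg A) = scl A" "hom (MC_dg A) x y n = gr A n"
  "diff (MC_dg A) x y n = tw A x y n" "dgcmp (MC_dg A) x y z m n g f = g * f"
  "dgid (MC_dg A) x = 1"
  by (auto simp: MC_dg_def tw_def)

locale curved =
  fixes A :: "('k::field, 'a::{ring,monoid_mult}) curved"
  assumes curved: "curved_algebra A"
begin

lemma graded: "graded_algebra (scl A) (gr A)"
  using curved by (simp add: curved_algebra_def)

sublocale vs: vector_space "scl A"
  using graded by (simp add: graded_algebra_def graded_space_def)

lemma gr_subspace: "vs.subspace (gr A n)"
  using graded by (simp add: graded_algebra_def graded_space_def)

lemmas gr_zero [simp] = vs.subspace_0[OF gr_subspace]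
  and gr_add = vs.subspace_add[OF gr_subspace]
  and gr_diff = vs.subspace_diff[OF gr_subspace]
  and gr_minus = vs.subspace_neg[OF gr_subspace]

lemma gr_koszul: "a \<in> gr A n \<Longrightarrow> koszul m a \<in> gr A n"
  by (simp add: koszul_def gr_minus)

lemma gr_one [simp]: "1 \<in> gr A 0"
  using graded by (simp add: graded_algebra_def)

text \<open>The degree of the product is a separate variable \<open>k\<close>, so that the rule also
  applies when that degree is not literally a sum.\<close>

lemma gr_mult: "a \<in> gr A m \<Longrightarrow> b \<in> gr A n \<Longrightarrow> k = m + n \<Longrightarrow> a * b \<in> gr A k"
  using graded by (auto simp: graded_algebra_def)

lemma gr_der: "a \<in> gr A n \<Longrightarrow> k = n + 1 \<Longrightarrow> der A a \<in> gr A k"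
  using curved by (auto simp: curved_algebra_def)

lemma gr_curv: "curv A \<in> gr A 2"
  using curved by (auto simp: curved_algebra_def)

lemma scl_mult_left: "scl A c a * b = scl A c (a * b)"
  and scl_mult_right: "a * scl A c b = scl A c (a * b)"
  using graded unfolding graded_algebra_def by metis+

lemma koszul_scl: "koszul m (scl A c a) = scl A c (koszul m a)"
  by (simp add: koszul_def)

lemma der_linear: "Vector_Spaces.linear (scl A) (scl A) (der A)"
  using curved by (simp add: curved_algebra_def)

sublocale der: Vector_Spaces.linear "scl A" "scl A" "der A"
  by (rule der_linear)

lemma der_koszul: "der A (koszul m a) = koszul m (der A a)"
  by (simp add: koszul_def der.neg)

lemma der_mult: "a \<in> gr A m \<Longrightarrow> b \<in> gr A n \<Longrightarrow>
    der A (a * b) = der A a * b + koszul m (a * der A b)"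
  using curved by (auto simp: curved_algebra_def)

lemma der_curv [simp]: "der A (curv A) = 0"
  using curved by (auto simp: curved_algebra_def)

lemma der_der: "a \<in> gr A n \<Longrightarrow> der A (der A a) = curv A * a - a * curv A"
  using curved by (auto simp: curved_algebra_def gcomm_def koszul_def)

lemma der_one: "der A 1 = 0"
  using der_mult[of 1 0 1 0] by simp

lemma tw_gr: "x \<in> gr A 1 \<Longrightarrow> y \<in> gr A 1 \<Longrightarrow> a \<in> gr A n \<Longrightarrow> k = n + 1 \<Longrightarrow> tw A x y n a \<in> gr A k"
  unfolding tw_def
  by (intro gr_diff gr_add gr_koszul gr_der[of a n] gr_mult[of _ 1 _ n] gr_mult[of _ n _ 1]) auto

lemma tw_add: "tw A x y n (a + b) = tw A x y n a + tw A x y n b"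
  by (simp add: tw_def der.add koszul_def algebra_simps)

lemma tw_minus: "tw A x y n (- a) = - tw A x y n a"
  by (simp add: tw_def der.neg koszul_def algebra_simps)

lemma tw_diff: "tw A x y n (a - b) = tw A x y n a - tw A x y n b"
  by (simp add: tw_def der.diff koszul_def algebra_simps)

lemma tw_zero [simp]: "tw A x y n 0 = 0"
  by (simp add: tw_def)

lemma tw_koszul: "tw A x y n (koszul m a) = koszul m (tw A x y n a)"
  by (simp add: koszul_def tw_minus)

lemma tw_scl: "tw A x y n (scl A c a) = scl A c (tw A x y n a)"
  by (simp add: tw_def der.scale koszul_scl scl_mult_left scl_mult_right
      vs.scale_right_distrib vs.scale_right_diff_distrib)

lemma tw_one: "tw A x x 0 1 = 0"
  by (simp add: tw_def der_one)

text \<open>The twist by the middle object \<open>y\<close> enters the two summands with opposite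
  signs and cancels, leaving the Leibniz rule of \<open>der A\<close>.\<close>

lemma tw_mult:
  assumes "g \<in> gr A m" "f \<in> gr A n" "k = m + n"
  shows "tw A x z k (g * f) = tw A y z m g * f + koszul m (g * tw A x y n f)"
  using assms(3)
  by (auto simp: tw_def der_mult[OF assms(1,2)] koszul_def algebra_simps)

lemma tw_tw:
  assumes "x \<in> gr A 1" "y \<in> gr A 1" "a \<in> gr A n" "k = n + 1"
  shows "tw A x y k (tw A x y n a) = twcurv A y * a - a * twcurv A x"
  unfolding assms(4) koszul_Suc tw_def twcurv_def
  by (simp add: der.add der.diff der_koszul der_der[OF assms(3)]
      der_mult[OF assms(2,3)] der_mult[OF assms(3,1)] koszul_mult_left koszul_mult_right
      koszul_add_arg koszul_diff_arg algebra_simps)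

lemma twcurv_gr: "x \<in> gr A 1 \<Longrightarrow> twcurv A x \<in> gr A 2"
  unfolding twcurv_def by (intro gr_add gr_curv gr_der[of x 1] gr_mult[of _ 1 _ 1]) auto

text \<open>The Bianchi identity. It supplies the cocycle condition on the curvature when an object
  is lifted.\<close>

lemma tw_twcurv: "x \<in> gr A 1 \<Longrightarrow> tw A x x 2 (twcurv A x) = 0"
  by (simp add: tw_def twcurv_def der.add der_der[of x 1] der_mult[of x 1 x 1] algebra_simps)

text \<open>When \<open>l * l = 0\<close>, making \<open>y - l\<close> flat is the linear equation
  \<open>tw A y y 1 l = twcurv A y\<close>.\<close>

lemma twcurv_diff: "twcurv A (y - l) = twcurv A y - tw A y y 1 l + l * l"
  by (simp add: tw_def twcurv_def der.diff algebra_simps)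

lemma MC_tw_tw: "x \<in> MC A \<Longrightarrow> y \<in> MC A \<Longrightarrow> a \<in> gr A n \<Longrightarrow> k = n + 1 \<Longrightarrow>
    tw A x y k (tw A x y n a) = 0"
  using tw_tw[of x y a n] by (simp add: MC_iff)

text \<open>Vanishing curvature enters through \<open>tw_tw\<close>, to make the differential square
  to zero; the other axioms hold for twists by any degree 1 elements.\<close>

lemma dg_category_MC_dg: "dg_category (MC_dg A)"
  unfolding dg_category_def MC_dg_simps linear_between_def
  by (intro conjI ballI allI vs.vector_space_axioms gr_subspace)
    (auto simp: MC_iff tw_gr tw_add tw_scl gr_mult distrib_left distrib_right scl_mult_left
      scl_mult_right tw_tw tw_mult mult.assoc tw_one)

section \<open>Homogeneous components\<close>

lemma component_ex:
  obtains c where "\<And>n. c n \<in> gr A n" "finite {n. c n \<noteq> 0}" "a = (\<Sum>n | c n \<noteq> 0. c n)"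
proof -
  have "\<exists>!c. (\<forall>n. c n \<in> gr A n) \<and> finite {n. c n \<noteq> 0} \<and> a = (\<Sum>n | c n \<noteq> 0. c n)"
    using graded unfolding graded_algebra_def graded_space_def by blast
  then show thesis
    by (elim ex1E conjE) (rule that, auto)
qed

lemma component_unique:
  assumes "\<And>n. c n \<in> gr A n" "finite {n. c n \<noteq> 0}" "\<And>n. c' n \<in> gr A n" "finite {n. c' n \<noteq> 0}"
    and "(\<Sum>n | c n \<noteq> 0. c n) = (\<Sum>n | c' n \<noteq> 0. c' n)"
  shows "c = c'"
proof -
  have "\<exists>!d. (\<forall>n. d n \<in> gr A n) \<and> finite {n. d n \<noteq> 0} \<and> (\<Sum>n | c n \<noteq> 0. c n) = (\<Sum>n | d n \<noteq> 0. d n)"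
    using graded unfolding graded_algebra_def graded_space_def by blast
  then obtain d where d: "\<And>e. (\<And>n. e n \<in> gr A n) \<Longrightarrow> finite {n. e n \<noteq> 0} \<Longrightarrow>
      (\<Sum>n | c n \<noteq> 0. c n) = (\<Sum>n | e n \<noteq> 0. e n) \<Longrightarrow> e = d"
    by (elim ex1E) blast
  show ?thesis
    using d[OF assms(1,2) refl] d[OF assms(3,4,5)] by simp
qed

end

section \<open>Isomorphisms in \<open>H\<^sup>0\<close>\<close>

lemma H0_simps [simp]:
  "obj (H0 C) = dgobj C" "mor (H0 C) x y = class0 C x y ` cocycles0 C x y"
  "cmp (H0 C) x y z V U = (\<Union>g\<in>V. \<Union>f\<in>U. class0 C x z (dgcmp C x y z 0 0 g f))"
  "idm (H0 C) x = class0 C x x (dgid C x)"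
  by (auto simp: H0_def)

context curved
begin

abbreviation "Z0 \<equiv> cocycles0 (MC_dg A)"
abbreviation "B0 \<equiv> coboundaries0 (MC_dg A)"
abbreviation "cl0 \<equiv> class0 (MC_dg A)"

lemma Z0_iff: "a \<in> Z0 x y \<longleftrightarrow> a \<in> gr A 0 \<and> tw A x y 0 a = 0"
  by (simp add: cocycles0_def)

lemma Z0_mult: "g \<in> Z0 y z \<Longrightarrow> f \<in> Z0 x y \<Longrightarrow> g * f \<in> Z0 x z"
  by (auto simp: Z0_iff gr_mult tw_mult[where m=0 and n=0 and y=y])

lemma B0_I: "s \<in> gr A (-1) \<Longrightarrow> a = tw A x y (-1) s \<Longrightarrow> a \<in> B0 x y"
  by (auto simp: coboundaries0_def)

lemma B0_E:
  assumes "a \<in> B0 x y"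
  obtains s where "s \<in> gr A (-1)" "a = tw A x y (-1) s"
  using assms by (auto simp: coboundaries0_def)

lemma B0_zero [simp]: "0 \<in> B0 x y"
  by (rule B0_I[of 0]) auto

lemma B0_add: "a \<in> B0 x y \<Longrightarrow> b \<in> B0 x y \<Longrightarrow> a + b \<in> B0 x y"
  by (elim B0_E, rule B0_I, rule gr_add) (auto simp: tw_add)

lemma B0_minus: "a \<in> B0 x y \<Longrightarrow> - a \<in> B0 x y"
  by (elim B0_E, rule B0_I, rule gr_minus) (auto simp: tw_minus)

lemma B0_diff: "a \<in> B0 x y \<Longrightarrow> b \<in> B0 x y \<Longrightarrow> a - b \<in> B0 x y"
  using B0_add[of a x y "- b"] B0_minus[of b] by simp

text \<open>As \<open>f\<close> is closed, the Leibniz rule shows that a primitive of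
  \<open>a\<close> times \<open>f\<close> is a primitive of \<open>a * f\<close>.\<close>

lemma B0_mult_Z0:
  assumes "a \<in> B0 y z" "f \<in> Z0 x y" shows "a * f \<in> B0 x z"
proof -
  obtain s where s: "s \<in> gr A (-1)" "a = tw A y z (-1) s"
    using assms(1) by (rule B0_E)
  show ?thesis
    by (rule B0_I[of "s * f"])
      (use s assms(2) in \<open>auto simp: Z0_iff gr_mult tw_mult[where m="-1" and n=0 and y=y]\<close>)
qed

lemma Z0_mult_B0:
  assumes "g \<in> Z0 y z" "a \<in> B0 x y" shows "g * a \<in> B0 x z"
proof -
  obtain s where s: "s \<in> gr A (-1)" "a = tw A x y (-1) s"
    using assms(2) by (rule B0_E)
  show ?thesis
    by (rule B0_I[of "g * s"])
      (use s assms(1) in \<open>auto simp: Z0_iff gr_mult tw_mult[where m=0 and n="-1" and y=y]\<close>)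
qed

lemma cl0_self: "f \<in> Z0 x y \<Longrightarrow> f \<in> cl0 x y f"
  by (simp add: class0_def)

lemma cl0_eqI:
  assumes "f - g \<in> B0 x y" shows "cl0 x y f = cl0 x y g"
proof -
  have "h - f \<in> B0 x y \<longleftrightarrow> h - g \<in> B0 x y" for h
    using B0_add[of "h - f" x y "f - g"] B0_diff[of "h - g" x y "f - g"] assms by auto
  then show ?thesis
    by (simp add: class0_def)
qed

text \<open>Changing representatives changes the product by a coboundary, so all members of the
  union defining composition are the same class.\<close>

lemma cmp_cl0:
  assumes "v \<in> Z0 y z" "u \<in> Z0 x y"
  shows "cmp (H0 (MC_dg A)) x y z (cl0 y z v) (cl0 x y u) = cl0 x z (v * u)"
proof -
  have eq: "cl0 x z (g * f) = cl0 x z (v * u)" if "g \<in> cl0 y z v" "f \<in> cl0 x y u" for g f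
  proof (rule cl0_eqI)
    have "g * f - v * u = (g - v) * f + v * (f - u)"
      by (simp add: algebra_simps)
    also have "\<dots> \<in> B0 x z"
      using that assms by (intro B0_add B0_mult_Z0[of _ y] Z0_mult_B0[of _ y]) (auto simp: class0_def)
    finally show "g * f - v * u \<in> B0 x z" .
  qed
  have "v \<in> cl0 y z v" "u \<in> cl0 x y u"
    using assms by (auto simp: cl0_self)
  then show ?thesis
    using eq unfolding H0_simps MC_dg_simps by blast
qed

lemma is_iso_H0I:
  assumes "u \<in> Z0 x y" "v \<in> Z0 y x" "v * u - 1 \<in> B0 x x" "u * v - 1 \<in> B0 y y"
  shows "is_iso (H0 (MC_dg A)) x y (cl0 x y u)"
  unfolding is_iso_def
proof (intro conjI bexI[of _ "cl0 y x v"])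
  show "cmp (H0 (MC_dg A)) x y x (cl0 y x v) (cl0 x y u) = idm (H0 (MC_dg A)) x"
    using cmp_cl0[OF assms(2,1)] cl0_eqI[OF assms(3)] by simp
  show "cmp (H0 (MC_dg A)) y x y (cl0 x y u) (cl0 y x v) = idm (H0 (MC_dg A)) y"
    using cmp_cl0[OF assms(1,2)] cl0_eqI[OF assms(4)] by simp
qed (use assms in auto)

lemma is_iso_H0E:
  assumes "is_iso (H0 (MC_dg A)) x y U"
  obtains u v where "U = cl0 x y u" "u \<in> Z0 x y" "v \<in> Z0 y x"
    "v * u - 1 \<in> B0 x x" "u * v - 1 \<in> B0 y y"
proof -
  obtain u v where uv: "U = cl0 x y u" "u \<in> Z0 x y" "v \<in> Z0 y x"
    "cmp (H0 (MC_dg A)) x y x (cl0 y x v) U = cl0 x x 1"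
    "cmp (H0 (MC_dg A)) y x y U (cl0 y x v) = cl0 y y 1"
    using assms unfolding is_iso_def by auto
  then have "cl0 x x (v * u) = cl0 x x 1" "cl0 y y (u * v) = cl0 y y 1"
    using cmp_cl0 by metis+
  \<comment> \<open>A cocycle lies in its own class, so equality of classes becomes membership,
    which unfolds to a coboundary condition.\<close>
  then have "v * u \<in> cl0 x x 1" "u * v \<in> cl0 y y 1"
    using uv cl0_self Z0_mult by metis+
  then show thesis
    using uv by (intro that[of u v]) (auto simp: class0_def)
qed

text \<open>In \<open>H0\<close> the class of \<open>v\<close> has left inverse \<open>w\<close> and
  right inverse \<open>u\<close>, so these agree and \<open>u\<close> is a left inverse too. The
  proof spells this out as one identity of coboundaries.\<close>

lemma left_inverse_iso:
  assumes "u \<in> Z0 x y" "v \<in> Z0 y x" "w \<in> Z0 x y"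
    and vu: "v * u - 1 \<in> B0 x x" and wv: "w * v - 1 \<in> B0 y y"
  shows "u * v - 1 \<in> B0 y y"
proof -
  have "u * v - 1 = (w * v - 1) + w * (v * u - 1) * v - (w * v - 1) * (u * v)"
    by (simp add: algebra_simps)
  also have "\<dots> \<in> B0 y y"
  proof (rule B0_diff[OF B0_add])
    show "w * (v * u - 1) * v \<in> B0 y y"
      using Z0_mult_B0[OF assms(3) vu] assms(2) by (rule B0_mult_Z0)
    show "(w * v - 1) * (u * v) \<in> B0 y y"
      using wv Z0_mult[OF assms(1,2)] by (rule B0_mult_Z0)
  qed (rule wv)
  finally show ?thesis .
qed

end

section \<open>Square zero extensions\<close>

locale square_zero = A: curved A + B: curved B
  for A :: "('k::field, 'a::{ring,monoid_mult}) curved"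
    and B :: "('k, 'b::{ring,monoid_mult}) curved" +
  fixes f :: "'a \<Rightarrow> 'b" and b :: 'b
  assumes ext: "square_zero_extension A B (f, b)"
begin

lemma f_map: "graded_algebra_map (scl A) (gr A) (scl B) (gr B) f"
  using ext by (simp add: square_zero_extension_def curved_morphism_def)

sublocale f: Vector_Spaces.linear "scl A" "scl B" f
  using f_map by (simp add: graded_algebra_map_def)

lemma f_gr: "a \<in> gr A n \<Longrightarrow> f a \<in> gr B n"
  and f_mult: "f (a * a') = f a * f a'"
  and f_one: "f 1 = 1"
  using f_map by (auto simp: graded_algebra_map_def)

lemma b_gr: "b \<in> gr B 1"
  and f_der: "a \<in> gr A n \<Longrightarrow> f (der A a) = der B (f a) + gcomm 1 n b (f a)"
  and f_curv: "f (curv A) = curv B + der B b + b * b"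
  using ext by (auto simp: square_zero_extension_def curved_morphism_def)

lemma ker_mult: "f l = 0 \<Longrightarrow> f l' = 0 \<Longrightarrow> l * l' = 0"
  and f_surj: "surj f"
  using ext by (auto simp: square_zero_extension_def)

lemma f_koszul: "f (koszul n a) = koszul n (f a)"
  by (simp add: koszul_def f.neg)

text \<open>The commutator with \<open>b\<close> in \<open>f_der\<close> is absorbed by shifting
  both objects by \<open>b\<close>. No Maurer-Cartan condition is imposed, so this also applies to
  arbitrary lifts of objects.\<close>

lemma f_tw: "a \<in> gr A n \<Longrightarrow> f (tw A x y n a) = tw B (b + f x) (b + f y) n (f a)"
  by (simp add: tw_def f.add f.diff f_koszul f_mult f_der[of a n] gcomm_def distrib_left distrib_right
      koszul_add_arg)

lemma f_twcurv: "x \<in> gr A 1 \<Longrightarrow> f (twcurv A x) = twcurv B (b + f x)"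
  by (simp add: twcurv_def f.add f_mult f_der[of x 1] f_curv gcomm_def B.der.add algebra_simps)

lemma f_MC: "x \<in> MC A \<Longrightarrow> b + f x \<in> MC B"
  using f_twcurv[of x] by (auto simp: MC_iff intro: B.gr_add b_gr f_gr f.zero)

text \<open>Surjectivity of \<open>f\<close> is given without degrees. As \<open>f\<close> preserves
  degrees, it maps components to components, so the degree \<open>n\<close> component of any
  preimage still maps to \<open>\<beta>\<close>.\<close>

lemma lift_gr:
  assumes "\<beta> \<in> gr B n"
  obtains a where "a \<in> gr A n" "f a = \<beta>"
proof -
  obtain a where a: "f a = \<beta>"
    using f_surj by (metis surjD)
  obtain c where c: "\<And>k. c k \<in> gr A k" "finite {k. c k \<noteq> 0}" "a = (\<Sum>k | c k \<noteq> 0. c k)"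
    using A.component_ex[of a] by blast
  \<comment> \<open>The decomposition of \<open>\<beta>\<close>, concentrated in degree
    \<open>n\<close>.\<close>
  define c' where "c' = (\<lambda>k. if k = n then \<beta> else 0)"
  have sub: "{k. f (c k) \<noteq> 0} \<subseteq> {k. c k \<noteq> 0}"
    by auto
  have "(\<lambda>k. f (c k)) = c'"
  proof (rule B.component_unique)
    show "finite {k. f (c k) \<noteq> 0}"
      using c(2) sub by (rule finite_subset[rotated])
    have *: "{k. c' k \<noteq> 0} \<subseteq> {n}"
      by (auto simp: c'_def)
    then show "finite {k. c' k \<noteq> 0}"
      by (rule finite_subset) simp
    have "(\<Sum>k | f (c k) \<noteq> 0. f (c k)) = (\<Sum>k | c k \<noteq> 0. f (c k))"
      using c(2) sub by (intro sum.mono_neutral_left) auto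
    also have "\<dots> = \<beta>"
      using a c(3) by (simp add: f.sum)
    also have "\<beta> = (\<Sum>k\<in>{n}. c' k)"
      by (simp add: c'_def)
    also have "\<dots> = (\<Sum>k | c' k \<noteq> 0. c' k)"
      using * by (intro sum.mono_neutral_right) auto
    finally show "(\<Sum>k | f (c k) \<noteq> 0. f (c k)) = (\<Sum>k | c' k \<noteq> 0. c' k)" .
  qed (use assms c(1) f_gr in \<open>auto simp: c'_def\<close>)
  then have "f (c n) = \<beta>"
    by (metis c'_def)
  with c(1) show thesis
    by (rule that)
qed

lemma dg_functor_MC: "dg_functor (MC_dg A) (MC_dg B) (MC_dg_map (f, b))"
  unfolding dg_functor_def MC_dg_map_def MC_dg_simps linear_between_def
  by (auto simp: A.dg_category_MC_dg B.dg_category_MC_dg f_MC f_gr f.add f.scale f_tw f_mult f_one)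

section \<open>The kernel as a square zero ideal\<close>

definition L :: "int \<Rightarrow> 'a set" where
  "L n = {a \<in> gr A n. f a = 0}"

lemma L_iff: "a \<in> L n \<longleftrightarrow> a \<in> gr A n \<and> f a = 0"
  by (simp add: L_def)

lemma L_diff: "l \<in> L n \<Longrightarrow> l' \<in> L n \<Longrightarrow> l - l' \<in> L n"
  and L_koszul: "l \<in> L n \<Longrightarrow> koszul m l \<in> L n"
  and L_minus: "l \<in> L n \<Longrightarrow> - l \<in> L n"
  by (auto simp: L_iff A.gr_diff A.gr_koszul A.gr_minus f.diff f.neg f_koszul)

lemma L_mult: "l \<in> L m \<Longrightarrow> a \<in> gr A n \<Longrightarrow> k = m + n \<Longrightarrow> l * a \<in> L k"
  by (simp add: L_iff A.gr_mult[of l m a n] f_mult)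

text \<open>The difference \<open>a - a'\<close> lies in the kernel, so \<open>l\<close> annihilates
  it: right multiplication on \<open>L\<close> factors through \<open>f\<close>.\<close>

lemma L_mult_cong: "l \<in> L n \<Longrightarrow> f a = f a' \<Longrightarrow> l * a = l * a'"
  using ker_mult[of l "a - a'"] by (simp add: L_iff f.diff algebra_simps)

text \<open>The second Leibniz term is a product of two kernel elements. Hence an \<open>a\<close>
  that is closed only modulo the kernel still acts on \<open>L\<close> as a chain map, up to no
  sign.\<close>

lemma tw_L_mult:
  assumes "l \<in> L m" "a \<in> gr A n" "f (tw A x y n a) = 0" "k = m + n"
  shows "tw A x z k (l * a) = tw A y z m l * a"
  using assms A.tw_mult[of l m a n k x z y] ker_mult[of l "tw A x y n a"] by (simp add: L_iff)

text \<open>Here \<open>U\<close> lies over a homotopy equivalence in \<open>B\<close>, with homotopy inverse and homotopies the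
  images of \<open>V\<close>, \<open>S\<close>, \<open>T\<close>. Since \<open>L\<close> is a \<open>B\<close>-bimodule, right multiplication by \<open>U\<close> is a
  homotopy equivalence between twists of \<open>L\<close>, so every cocycle \<open>(p, q)\<close> of its cone is a
  coboundary.\<close>

lemma cone_acyclic:
  assumes U: "U \<in> gr A 0" "f (tw A x y 0 U) = 0" and V: "V \<in> gr A 0" "f (tw A y x 0 V) = 0"
    and S: "S \<in> gr A (-1)" "f (V * U) = f (1 + tw A x x (-1) S)"
    and T: "T \<in> gr A (-1)" "f (U * V) = f (1 + tw A y y (-1) T)"
    and p: "p \<in> L (n + 1)" "tw A y z (n + 1) p = 0"
    and q: "q \<in> L n" "tw A x z n q = p * U"
  obtains p' q' where "p' \<in> L n" "q' \<in> L (n - 1)" "tw A y z n p' = p"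
    "p' * U - q = tw A x z (n - 1) q'"
proof -
  \<comment> \<open>A primitive of \<open>p\<close>: the differential of \<open>q * V\<close> is
    \<open>p * (U * V)\<close>, and the term with \<open>T\<close> removes its deviation from
    \<open>p\<close>.\<close>
  define p1 where "p1 = q * V + koszul n (p * T)"
  \<comment> \<open>The error of \<open>p1\<close> in the second component. It is closed because
    \<open>p1 * U\<close> and \<open>q\<close> both have differential \<open>p * U\<close>.\<close>
  define c where "c = p1 * U - q"
  \<comment> \<open>Subtracting the closed element \<open>c * V\<close> keeps the primitive of
    \<open>p\<close> and turns the error into \<open>c - c * (V * U)\<close>, which \<open>S\<close>
    makes exact.\<close>
  define p' where "p' = p1 - c * V"
  define q' where "q' = - koszul n (c * S)"
  have p1: "p1 \<in> L n"
    using L_diff[OF L_mult[OF q(1) V(1)] L_minus[OF L_koszul[OF L_mult[OF p(1) T(1)]]]]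
    by (simp add: p1_def)
  have c: "c \<in> L n"
    unfolding c_def by (intro L_diff q L_mult[OF p1 U(1)]) simp
  \<comment> \<open>The minus sign arises because \<open>p\<close> has degree
    \<open>n + 1\<close>.\<close>
  have "tw A y z n (p * T) = - koszul n (p * tw A y y (-1) T)"
    using A.tw_mult[of p "n + 1" T "-1" n y z y] p T by (simp add: L_iff koszul_Suc)
  then have "tw A y z n p1 = p * (U * V) - p * tw A y y (-1) T"
    unfolding p1_def
    by (simp add: A.tw_add A.tw_koszul koszul_minus_arg tw_L_mult[OF q(1) V] q(2) mult.assoc)
  also have "p * (U * V) = p * (1 + tw A y y (-1) T)"
    using p(1) T(2) by (rule L_mult_cong)
  finally have dp1: "tw A y z n p1 = p"
    by (simp add: distrib_left)
  have dc: "tw A x z n c = 0"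
    unfolding c_def by (simp add: A.tw_diff tw_L_mult[OF p1 U] dp1 q(2))
  have "tw A x z (n - 1) (c * S) = koszul n (c * tw A x x (-1) S)"
    using A.tw_mult[of c n S "-1" "n - 1" x z x] c S dc by (simp add: L_iff)
  then have dq': "tw A x z (n - 1) q' = - (c * tw A x x (-1) S)"
    unfolding q'_def by (simp add: A.tw_minus A.tw_koszul)
  have "c * (V * U) = c * (1 + tw A x x (-1) S)"
    using c S(2) by (rule L_mult_cong)
  then have eq: "p' * U - q = tw A x z (n - 1) q'"
    unfolding dq' p'_def by (simp add: c_def algebra_simps)
  show thesis
  proof (rule that[OF _ _ _ eq])
    show "p' \<in> L n"
      unfolding p'_def by (intro L_diff p1 L_mult[OF c V(1)]) simp
    show "q' \<in> L (n - 1)"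
      unfolding q'_def by (intro L_minus L_koszul L_mult[OF c S(1)]) simp
    show "tw A y z n p' = p"
      unfolding p'_def by (simp add: A.tw_diff tw_L_mult[OF c V] dp1 dc)
  qed
qed

section \<open>Lifting homotopy inverses and homotopy equivalences\<close>

lemma lift_left_inverse:
  assumes x: "x \<in> MC A" and y: "y \<in> MC A" and U: "U \<in> A.Z0 x y"
    and v: "v \<in> B.Z0 (b + f y) (b + f x)"
    and vU: "v * f U - 1 \<in> B.B0 (b + f x) (b + f x)"
    and Uv: "f U * v - 1 \<in> B.B0 (b + f y) (b + f y)"
  obtains V where "V \<in> A.Z0 y x" "f V = v" "V * U - 1 \<in> A.B0 x x"
proof -
  have x1: "x \<in> gr A 1" and y1: "y \<in> gr A 1"
    using x y by (auto simp: MC_iff)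
  have U0: "U \<in> gr A 0" "tw A x y 0 U = 0"
    using U by (auto simp: A.Z0_iff)
  have v0: "v \<in> gr B 0" "tw B (b + f y) (b + f x) 0 v = 0"
    using v by (auto simp: B.Z0_iff)
  obtain V where V: "V \<in> gr A 0" "f V = v"
    using lift_gr[OF v0(1)] .
  obtain s where s: "s \<in> gr B (-1)" "v * f U - 1 = tw B (b + f x) (b + f x) (-1) s"
    using vU by (rule B.B0_E)
  obtain S where S: "S \<in> gr A (-1)" "f S = s"
    using lift_gr[OF s(1)] .
  obtain t where t: "t \<in> gr B (-1)" "f U * v - 1 = tw B (b + f y) (b + f y) (-1) t"
    using Uv by (rule B.B0_E)
  obtain T where T: "T \<in> gr A (-1)" "f T = t"
    using lift_gr[OF t(1)] .
  have fV: "f (tw A y x 0 V) = 0"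
    using f_tw[OF V(1)] V v0 by simp
  have fS: "f (V * U) = f (1 + tw A x x (-1) S)"
    using f_tw[OF S(1), of x x] S V s by (simp add: f_mult f.add f_one algebra_simps)
  have fT: "f (U * V) = f (1 + tw A y y (-1) T)"
    using f_tw[OF T(1), of y y] T V t by (simp add: f_mult f.add f_one algebra_simps)
  \<comment> \<open>For arbitrary lifts \<open>V\<close> and \<open>S\<close>, \<open>p\<close>
    measures the failure of \<open>V\<close> to be closed and \<open>q\<close> the failure of
    \<open>S\<close> to be a homotopy from \<open>V * U\<close> to 1. Closedness of \<open>U\<close>
    makes the pair a cone cocycle; its primitive corrects \<open>V\<close> and
    \<open>S\<close>.\<close>
  define p where "p = tw A y x 0 V"
  define q where "q = V * U - (1 + tw A x x (-1) S)"
  have p: "p \<in> L (0 + 1)"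
    using A.tw_gr[OF y1 x1 V(1)] fV by (simp add: L_iff p_def)
  have dp: "tw A y x (0 + 1) p = 0"
    unfolding p_def using A.MC_tw_tw[OF y x V(1)] by simp
  have q: "q \<in> L 0"
    unfolding q_def L_iff using fS V(1) U0(1) A.tw_gr[OF x1 x1 S(1)]
    by (auto simp: f.diff intro!: A.gr_diff A.gr_add A.gr_mult[of _ 0 _ 0])
  have dq: "tw A x x 0 q = p * U"
    unfolding q_def p_def using A.tw_mult[OF V(1) U0(1), of 0 x x y] U0(2) A.MC_tw_tw[OF x x S(1), of 0]
    by (simp add: A.tw_diff A.tw_add A.tw_one)
  have fU: "f (tw A x y 0 U) = 0"
    using U0(2) by simp
  obtain p' q' where pq: "p' \<in> L 0" "q' \<in> L (0 - 1)" "tw A y x 0 p' = p"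
    "p' * U - q = tw A x x (0 - 1) q'"
    using cone_acyclic[OF U0(1) fU V(1) fV S(1) fS T(1) fT p dp q dq] .
  note p' = pq(1,3) and q' = pq(2,4)
  show thesis
  proof (rule that[of "V - p'"])
    show "V - p' \<in> A.Z0 y x"
      using p' V by (simp add: A.Z0_iff L_iff A.gr_diff A.tw_diff p_def)
    show "f (V - p') = v"
      using p' V by (simp add: L_iff f.diff)
    have "(V - p') * U - 1 = tw A x x (-1) (S - q')"
      using q'(2) by (simp add: A.tw_diff q_def algebra_simps)
    moreover have "S - q' \<in> gr A (-1)"
      using q'(1) S(1) by (simp add: L_iff A.gr_diff)
    ultimately show "(V - p') * U - 1 \<in> A.B0 x x"
      by (intro A.B0_I)
  qed
qed

lemma lift_homotopy_equivalence:
  assumes x: "x \<in> MC A" and y: "y \<in> MC B" and u: "u \<in> B.Z0 (b + f x) y"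
    and v: "v \<in> B.Z0 y (b + f x)"
    and vu: "v * u - 1 \<in> B.B0 (b + f x) (b + f x)" and uv: "u * v - 1 \<in> B.B0 y y"
  obtains x' U where "x' \<in> MC A" "b + f x' = y" "U \<in> A.Z0 x x'" "f U = u"
proof -
  have x1: "x \<in> gr A 1" "twcurv A x = 0" and y1: "y \<in> gr B 1" "twcurv B y = 0"
    using x y by (auto simp: MC_iff)
  have u0: "u \<in> gr B 0" "tw B (b + f x) y 0 u = 0"
    using u by (auto simp: B.Z0_iff)
  have v0: "v \<in> gr B 0" "tw B y (b + f x) 0 v = 0"
    using v by (auto simp: B.Z0_iff)
  \<comment> \<open>The shift by \<open>b\<close> is there because objects map by
    \<open>b + f x\<close>.\<close>
  obtain Y where Y: "Y \<in> gr A 1" "f Y = y - b"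
    using lift_gr[OF B.gr_diff[OF y1(1) b_gr]] .
  then have bY: "b + f Y = y"
    by simp
  obtain U where U: "U \<in> gr A 0" "f U = u"
    using lift_gr[OF u0(1)] .
  obtain V where V: "V \<in> gr A 0" "f V = v"
    using lift_gr[OF v0(1)] .
  obtain s where s: "s \<in> gr B (-1)" "v * u - 1 = tw B (b + f x) (b + f x) (-1) s"
    using vu by (rule B.B0_E)
  obtain S where S: "S \<in> gr A (-1)" "f S = s"
    using lift_gr[OF s(1)] .
  obtain t where t: "t \<in> gr B (-1)" "u * v - 1 = tw B y y (-1) t"
    using uv by (rule B.B0_E)
  obtain T where T: "T \<in> gr A (-1)" "f T = t"
    using lift_gr[OF t(1)] .
  have fU: "f (tw A x Y 0 U) = 0"
    using f_tw[OF U(1)] U u0 bY by simp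
  have fV: "f (tw A Y x 0 V) = 0"
    using f_tw[OF V(1)] V v0 bY by simp
  have fS: "f (V * U) = f (1 + tw A x x (-1) S)"
    using f_tw[OF S(1), of x x] S V U s by (simp add: f_mult f.add f_one algebra_simps)
  have fT: "f (U * V) = f (1 + tw A Y Y (-1) T)"
    using f_tw[OF T(1), of Y Y, unfolded bY] T V U t by (simp add: f_mult f.add f_one algebra_simps)
  \<comment> \<open>The cone cocycle for \<open>n = 1\<close>: its conditions are the Bianchi
    identity for \<open>Y\<close> and \<open>tw_tw\<close> with the curvature of \<open>x\<close>
    zero.\<close>
  have p: "twcurv A Y \<in> L (1 + 1)"
    using A.twcurv_gr[OF Y(1)] f_twcurv[OF Y(1)] bY y1 by (simp add: L_iff)
  have dp: "tw A Y Y (1 + 1) (twcurv A Y) = 0"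
    using A.tw_twcurv[OF Y(1)] by simp
  have q: "tw A x Y 0 U \<in> L 1"
    using A.tw_gr[OF x1(1) Y(1) U(1)] fU by (simp add: L_iff)
  have dq: "tw A x Y 1 (tw A x Y 0 U) = twcurv A Y * U"
    using A.tw_tw[OF x1(1) Y(1) U(1)] x1(2) by simp
  obtain l m where lm: "l \<in> L 1" "m \<in> L (1 - 1)" "tw A Y Y 1 l = twcurv A Y"
    "l * U - tw A x Y 0 U = tw A x Y (1 - 1) m"
    using cone_acyclic[OF U(1) fU V(1) fV S(1) fS T(1) fT p dp q dq] .
  note l = lm(1,3) and m = lm(2,4)
  \<comment> \<open>These products are the nonlinear terms: \<open>l * l\<close> in the curvature of
    \<open>Y - l\<close>, and \<open>l * m\<close> in the differential of \<open>U + m\<close> with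
    target \<open>Y - l\<close>.\<close>
  have l0: "l * l = 0" "l * m = 0"
    using l(1) m(1) by (auto simp: L_iff ker_mult)
  show thesis
  proof (rule that[of "Y - l" "U + m"])
    show "Y - l \<in> MC A"
      using Y l l0 by (simp add: MC_iff A.gr_diff L_iff A.twcurv_diff)
    show "b + f (Y - l) = y"
      using l bY by (simp add: L_iff f.diff)
    show "f (U + m) = u"
      using m U by (simp add: L_iff f.add)
    have "tw A x (Y - l) 0 (U + m) = tw A x Y 0 U + tw A x Y 0 m - l * U - l * m"
      by (simp add: tw_def A.der.add algebra_simps)
    also have "\<dots> = 0"
      using m(2) l0 by (simp add: algebra_simps)
    finally show "U + m \<in> A.Z0 x (Y - l)"
      using U(1) m(1) by (simp add: A.Z0_iff A.gr_add L_iff)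
  qed
qed

section \<open>The induced functor on \<open>H0\<close> and the fibration property\<close>

lemma f_B0:
  assumes "a \<in> A.B0 x y" shows "f a \<in> B.B0 (b + f x) (b + f y)"
proof -
  obtain s where "s \<in> gr A (-1)" "a = tw A x y (-1) s"
    using assms by (rule A.B0_E)
  then show ?thesis
    by (intro B.B0_I[of "f s"]) (simp_all add: f_gr f_tw)
qed

text \<open>Since \<open>f\<close> preserves coboundaries, the union over representatives collapses
  to a single class.\<close>

lemma H0_functor_cl0:
  assumes "U \<in> A.Z0 x y"
  shows "snd (H0_functor (MC_dg B) (MC_dg_map (f, b))) x y (A.cl0 x y U)
    = B.cl0 (b + f x) (b + f y) (f U)"
proof -
  have "B.cl0 (b + f x) (b + f y) (f g) = B.cl0 (b + f x) (b + f y) (f U)"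
    if "g \<in> A.cl0 x y U" for g
    using f_B0[of "g - U" x y] that by (intro B.cl0_eqI) (simp add: class0_def f.diff)
  with A.cl0_self[OF assms] have
    "(\<Union>g\<in>A.cl0 x y U. B.cl0 (b + f x) (b + f y) (f g)) = B.cl0 (b + f x) (b + f y) (f U)"
    by blast
  then show ?thesis
    by (simp add: H0_functor_def MC_dg_map_def)
qed

lemma isofibration_H0:
  "isofibration (H0 (MC_dg A)) (H0 (MC_dg B)) (H0_functor (MC_dg B) (MC_dg_map (f, b)))"
  (is "isofibration _ _ ?F")
  unfolding isofibration_def
proof (intro ballI allI impI)
  fix x y u'
  have F: "fst ?F x = b + f x" for x
    by (simp add: H0_functor_def MC_dg_map_def)
  assume "x \<in> obj (H0 (MC_dg A))" "y \<in> obj (H0 (MC_dg B))" "is_iso (H0 (MC_dg B)) (fst ?F x) y u'"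
  then have x: "x \<in> MC A" and y: "y \<in> MC B" and iso: "is_iso (H0 (MC_dg B)) (b + f x) y u'"
    by (simp_all add: F)
  obtain u v where u: "u' = B.cl0 (b + f x) y u" "u \<in> B.Z0 (b + f x) y" and v: "v \<in> B.Z0 y (b + f x)"
    and vu: "v * u - 1 \<in> B.B0 (b + f x) (b + f x)" and uv: "u * v - 1 \<in> B.B0 y y"
    using iso by (rule B.is_iso_H0E)
  obtain x' U where x': "x' \<in> MC A" "b + f x' = y" and U: "U \<in> A.Z0 x x'" "f U = u"
    using lift_homotopy_equivalence[OF x y u(2) v vu uv] .
  obtain V where V: "V \<in> A.Z0 x' x" "f V = v" "V * U - 1 \<in> A.B0 x x"
    using lift_left_inverse[OF x x'(1) U(1), of v] U(2) x'(2) v vu uv by auto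
  \<comment> \<open>The same lifting with the roles of \<open>u\<close> and \<open>v\<close>
    exchanged. \<open>W\<close> need not equal \<open>U\<close>; as a left inverse of
    \<open>V\<close> it makes \<open>V\<close> a two-sided inverse of \<open>U\<close> in
    \<open>H0\<close>.\<close>
  obtain W where W: "W \<in> A.Z0 x x'" "W * V - 1 \<in> A.B0 x' x'"
    using lift_left_inverse[OF x'(1) x V(1), of u] V(2) x'(2) u vu uv by auto
  have "is_iso (H0 (MC_dg A)) x x' (A.cl0 x x' U)"
    using A.left_inverse_iso[OF U(1) V(1) W(1) V(3) W(2)] U V by (intro A.is_iso_H0I)
  moreover have "snd ?F x x' (A.cl0 x x' U) = u'"
    using H0_functor_cl0[OF U(1)] U u x' by simp
  ultimately show "\<exists>x'\<in>obj (H0 (MC_dg A)). \<exists>v. is_iso (H0 (MC_dg A)) x x' v \<and> fst ?F x' = y \<and>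
      snd ?F x x' v = u'"
    using x' by (auto simp: F)
qed

lemma dg_fibration_MC: "dg_fibration (MC_dg A) (MC_dg B) (MC_dg_map (f, b))"
  unfolding dg_fibration_def
proof (intro conjI ballI allI dg_functor_MC isofibration_H0)
  have "f ` gr A n = gr B n" for n
  proof
    show "gr B n \<subseteq> f ` gr A n"
      by (metis imageI lift_gr subsetI)
  qed (auto simp: f_gr)
  then show "snd (MC_dg_map (f, b)) x y n ` hom (MC_dg A) x y n =
      hom (MC_dg B) (fst (MC_dg_map (f, b)) x) (fst (MC_dg_map (f, b)) y) n" for x y n
    by (simp add: MC_dg_map_def)
qed

end

theorem theorem6p1:
  fixes A :: "('k::field, 'a::{ring,monoid_mult}) curved"
    and B :: "('k, 'b::{ring,monoid_mult}) curved"
    and \<pi> :: "('a \<Rightarrow> 'b) \<times> 'b"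
  assumes "perfect_field TYPE('k)"
    and "curved_algebra A" and "curved_algebra B"
    and "square_zero_extension A B \<pi>"
  shows "dg_fibration (MC_dg A) (MC_dg B) (MC_dg_map \<pi>)"
proof -
  obtain f b where \<pi>: "\<pi> = (f, b)"
    by fastforce
  interpret square_zero A B f b
    using assms unfolding \<pi> by unfold_locales
  show ?thesis
    using dg_fibration_MC by (simp add: \<pi>)
qed

end
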